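(* Let $q$ be an odd prime. Let $n$ and $k$ be integers with $n>k\ge1$, and let $x\in\mathbb{F}_q$. Then $${}_{n+1}F_n(x)=\frac{\phi(-1)^k}{q}\sum_{\lambda\in\mathbb{F}_q}\phi(\lambda)\cdot{}_{n+1-k}F_{n-k}(\lambda x)\;{}_kF_{k-1}(\lambda).$$ In particular, for any integer $k\ge 2$, $$q\,\phi(-1)^k\cdot{}_{2k}F_{2k-1}(1)=\sum_{\lambda\in\mathbb{F}_q}\phi(\lambda)\cdot{}_kF_{k-1}(\lambda)^2.$$
   Context: $\mathbb{F}_q$ is the finite field with $q$ elements; $\epsilon$ and $\phi$ are the trivial and quadratic multiplicative characters of $\mathbb{F}_q$. Every multiplicative character $\chi$ (including $\epsilon$) is extended to $\mathbb{F}_q$ by $\chi(0)=0$; $\overline{\chi}$ is the inverse character. For multiplicative characters $A,B$: $J(A,B)=\sum_{x\in\mathbb{F}_q}A(x)B(1-x)$ and $\binom{A}{B}=\frac{B(-1)}{q}J(A,\overline{B})$. For $n\ge1$ and $x\in\mathbb{F}_q$, $${}_{n+1}F_n(x):={}_{n+1}F_n\left(\begin{matrix}\phi & \phi & \cdots & \phi\\ & \epsilon & \cdots & \epsilon\end{matrix}\ \middle|\ x\right)=\frac{q}{q-1}\sum_{\chi}\binom{\phi\chi}{\chi}^{n+1}\chi(x),$$ the sum running over all multiplicative characters $\chi$ of $\mathbb{F}_q$; and ${}_1F_0(x)={}_1F_0(\phi\mid x)=\epsilon(x)\phi(1-x)$. *)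

theory Defs
  imports Complex_Main "HOL-Library.FuncSet" "HOL-Library.Cardinality" "HOL-Computational_Algebra.Primes"
begin

text \<open>
  The field with \<open>q\<close> elements is any type \<open>'a :: {field, finite}\<close> with \<^term>\<open>CARD('a) = q\<close>.
  A multiplicative character is a homomorphism from the nonzero elements to the nonzero complex
  numbers, represented by its extension to the whole field with value 0 at 0. In particular the
  pointwise product and the pointwise inverse (\<^prop>\<open>inverse (0::complex) = 0\<close>) of characters are
  their product and inverse as characters.
\<close>

definition mult_char :: "('a::{field,finite} \<Rightarrow> complex) \<Rightarrow> bool" where
  "mult_char \<chi> \<longleftrightarrow>
     \<chi> 0 = 0 \<and> (\<forall>x. x \<noteq> 0 \<longrightarrow> \<chi> x \<noteq> 0) \<and>
     (\<forall>x y. x \<noteq> 0 \<longrightarrow> y \<noteq> 0 \<longrightarrow> \<chi> (x * y) = \<chi> x * \<chi> y)"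

definition triv_char :: "'a::{field,finite} \<Rightarrow> complex" where
  "triv_char x = (if x = 0 then 0 else 1)"

text \<open>The quadratic character; this is a character of order 2 only when \<^term>\<open>CARD('a)\<close> is odd.\<close>

definition quad_char :: "'a::{field,finite} \<Rightarrow> complex" where
  "quad_char x = (if x = 0 then 0 else if \<exists>y. x = y\<^sup>2 then 1 else - 1)"

definition char_mult :: "('a \<Rightarrow> complex) \<Rightarrow> ('a \<Rightarrow> complex) \<Rightarrow> 'a::{field,finite} \<Rightarrow> complex" where
  "char_mult A B x = A x * B x"

definition char_inv :: "('a \<Rightarrow> complex) \<Rightarrow> 'a::{field,finite} \<Rightarrow> complex" where
  "char_inv A x = inverse (A x)"

definition jacobi_sum :: "('a::{field,finite} \<Rightarrow> complex) \<Rightarrow> ('a \<Rightarrow> complex) \<Rightarrow> complex" where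
  "jacobi_sum A B = (\<Sum>x\<in>UNIV. A x * B (1 - x))"

definition char_binom :: "('a::{field,finite} \<Rightarrow> complex) \<Rightarrow> ('a \<Rightarrow> complex) \<Rightarrow> complex" where
  "char_binom A B = B (- 1) / of_nat CARD('a) * jacobi_sum A (char_inv B)"

text \<open>
  \<open>hypF n\<close> is the function \<open>\<^sub>n\<^sub>+\<^sub>1F\<^sub>n\<close> with all upper parameters the quadratic and all lower
  parameters the trivial character: the index is the number of lower parameters.
\<close>

definition hypF :: "nat \<Rightarrow> 'a::{field,finite} \<Rightarrow> complex" where
  "hypF n x =
     (if n = 0 then triv_char x * quad_char (1 - x)
      else of_nat CARD('a) / (of_nat CARD('a) - 1) *
        (\<Sum>\<chi> | mult_char \<chi>. char_binom (char_mult quad_char \<chi>) \<chi> ^ (n + 1) * \<chi> x))"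

text \<open>The sum over all characters in the definition above is a finite sum.\<close>

lemma finite_mult_chars: "finite {\<chi> :: 'a::{field,finite} \<Rightarrow> complex. mult_char \<chi>}"
proof -
  define U :: "'a set" where "U = {x. x \<noteq> 0}"
  define N where "N = card U"
  have "1 \<in> U" and "finite U"
    by (simp_all add: U_def)
  then have N: "N > 0"
    unfolding N_def by (metis card_gt_0_iff empty_iff)
  have root: "\<chi> a ^ N = 1" if \<chi>: "mult_char \<chi>" and a: "a \<noteq> 0" for \<chi> :: "'a \<Rightarrow> complex" and a
  proof -
    let ?P = "\<Prod>x\<in>U. \<chi> x"
    have "bij_betw (\<lambda>x. a * x) U U"
      by (rule bij_betwI[of _ _ _ "\<lambda>x. x / a"]) (use a in \<open>simp_all add: U_def\<close>)
    then have "?P = (\<Prod>x\<in>U. \<chi> (a * x))"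
      by (rule prod.reindex_bij_betw[symmetric])
    also have "\<dots> = (\<Prod>x\<in>U. \<chi> a * \<chi> x)"
      using \<chi> a by (intro prod.cong) (simp_all add: mult_char_def U_def)
    also have "\<dots> = \<chi> a ^ N * ?P"
      by (simp add: prod.distrib N_def)
    finally have "?P = \<chi> a ^ N * ?P" .
    moreover have "?P \<noteq> 0"
      using \<chi> \<open>finite U\<close> by (simp add: mult_char_def U_def)
    ultimately show ?thesis
      by (metis mult_cancel_right1)
  qed
  let ?R = "insert 0 {z::complex. z ^ N = 1}"
  have "finite ?R"
    using N by (simp add: finite_roots_unity Suc_leI)
  then have "finite (PiE (UNIV::'a set) (\<lambda>_. ?R))"
    by (simp add: finite_PiE)
  moreover have "{\<chi> :: 'a \<Rightarrow> complex. mult_char \<chi>} \<subseteq> PiE UNIV (\<lambda>_. ?R)"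
  proof
    fix \<chi> :: "'a \<Rightarrow> complex"
    assume "\<chi> \<in> {\<chi>. mult_char \<chi>}"
    then have \<chi>: "mult_char \<chi>" by simp
    have "\<chi> x \<in> ?R" for x
      using root[OF \<chi>, of x] \<chi> by (cases "x = 0") (simp_all add: mult_char_def)
    then show "\<chi> \<in> PiE UNIV (\<lambda>_. ?R)"
      by (simp add: PiE_def Pi_def)
  qed
  ultimately show ?thesis
    by (rule finite_subset[rotated])
qed

end

theory Submission
  imports Defs "HOL-Algebra.Multiplicative_Group"
begin

text \<open>
  Write \<open>b(\<chi>)\<close> for the binomial of \<open>\<phi>\<chi>\<close> over \<open>\<chi>\<close>. Orthogonality over the characters, applied to
  the definition of the Jacobi sum, shows that the closed form of \<open>\<^sub>1F\<^sub>0\<close> agrees with the character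
  sum defining \<open>\<^sub>n\<^sub>+\<^sub>1F\<^sub>n\<close> at \<open>n = 0\<close>. Expanding both factors on the right-hand side, orthogonality
  over \<open>\<lambda>\<close> leaves only the pairs of characters with \<open>\<psi> = \<phi>\<chi>\<inverse>\<close>, and the symmetry of the Jacobi
  sum gives \<open>b(\<phi>\<chi>\<inverse>) = \<phi>(-1) b(\<chi>)\<close>.
\<close>

section \<open>Multiplicative characters\<close>

lemma mult_char_0: "mult_char \<chi> \<Longrightarrow> \<chi> 0 = 0"
  by (simp add: mult_char_def)

lemma mult_char_eq_0_iff: "mult_char \<chi> \<Longrightarrow> \<chi> x = 0 \<longleftrightarrow> x = 0"
  by (auto simp: mult_char_def)

lemma mult_char_mult: "mult_char \<chi> \<Longrightarrow> \<chi> (x * y) = \<chi> x * \<chi> y"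
  by (cases "x = 0 \<or> y = 0") (auto simp: mult_char_def)

lemma mult_char_1: "mult_char \<chi> \<Longrightarrow> \<chi> 1 = 1"
  using mult_char_mult[of \<chi> 1 1] mult_char_eq_0_iff[of \<chi> 1] by simp

lemma mult_char_inverse: "mult_char \<chi> \<Longrightarrow> \<chi> (inverse x) = inverse (\<chi> x)"
  using mult_char_mult[of \<chi> x "inverse x"] mult_char_1[of \<chi>] mult_char_0[of \<chi>]
  by (cases "x = 0") (auto dest: inverse_unique)

lemma mult_char_minus_1_square: "mult_char \<chi> \<Longrightarrow> \<chi> (- 1) * \<chi> (- 1) = 1"
  using mult_char_mult[of \<chi> "-1" "-1"] mult_char_1[of \<chi>] by simp

lemma mult_char_inverse_minus_1: "mult_char \<chi> \<Longrightarrow> inverse (\<chi> (- 1)) = \<chi> (- 1)"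
  using mult_char_minus_1_square inverse_unique by blast

lemma mult_char_triv_char: "mult_char triv_char"
  by (auto simp: mult_char_def triv_char_def)

lemma mult_char_char_mult: "mult_char A \<Longrightarrow> mult_char B \<Longrightarrow> mult_char (char_mult A B)"
  by (auto simp: mult_char_def char_mult_def)

lemma mult_char_char_inv: "mult_char A \<Longrightarrow> mult_char (char_inv A)"
  by (auto simp: mult_char_def char_inv_def)

text \<open>The multiplicative group of a finite field is cyclic. To import this from HOL-Algebra,
  the type is repackaged as the record \<open>R\<close>, whose powers agree with those of the type
  class.\<close>

lemma ex_primitive_element:
  "\<exists>g::'a::{field,finite}. g \<noteq> 0 \<and> (\<forall>x. x \<noteq> 0 \<longrightarrow> (\<exists>i::nat. x = g ^ i))"
proof -
  define R :: "'a ring" where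
    "R = \<lparr>carrier = UNIV, monoid.mult = (*), one = 1, ring.zero = 0, add = (+)\<rparr>"
  have "\<exists>y. x * y = 1" if "x \<noteq> 0" for x :: 'a
    using that right_inverse by blast
  moreover have "\<exists>y. x + y = 0" for x :: 'a
    using add.right_inverse by blast
  ultimately have "Ring.field R"
    unfolding R_def by unfold_locales (auto simp: algebra_simps Units_def)
  then interpret R: Ring.field R .
  have pow: "x [^]\<^bsub>R\<^esub> i = x ^ i" for x and i :: nat
    by (induction i) (simp_all add: R_def mult.commute)
  have "finite (carrier R)"
    by (simp add: R_def)
  then obtain a where "a \<in> carrier (mult_of R)"
    and gen: "carrier (mult_of R) = {a [^]\<^bsub>R\<^esub> i | i::nat. i \<in> UNIV}"
    using R.finite_field_mult_group_has_gen by blast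
  then have "a \<noteq> 0"
    by (simp add: R_def)
  moreover have "\<exists>i. x = a ^ i" if "x \<noteq> 0" for x
  proof -
    have "x \<in> carrier (mult_of R)"
      using that by (simp add: R_def)
    then show ?thesis
      unfolding gen pow by blast
  qed
  ultimately show ?thesis
    by blast
qed

lemma power_eq_power_iff_diff:
  fixes a :: "'a::field"
  assumes "a \<noteq> 0" and "i \<le> j"
  shows "a ^ i = a ^ j \<longleftrightarrow> a ^ (j - i) = 1"
  using assms by (auto simp: power_diff)

lemma power_mod_exponent:
  fixes a :: "'a::monoid_mult"
  assumes "a ^ N = 1"
  shows "a ^ n = a ^ (n mod N)"
proof -
  have "a ^ n = (a ^ N) ^ (n div N) * a ^ (n mod N)"
    by (simp flip: power_mult power_add)
  then show ?thesis
    by (simp add: assms)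
qed

text \<open>A generator \<open>g\<close> is sent to a complex root of unity of the same order. The
  resulting single character detects every \<open>x\<close> other than 1, which is what
  orthogonality over the characters needs.\<close>

lemma ex_faithful_char:
  "\<exists>\<chi>::'a::{field,finite} \<Rightarrow> complex. mult_char \<chi> \<and> (\<forall>x. \<chi> x = 1 \<longrightarrow> x = 1)"
proof -
  obtain g :: 'a where g: "g \<noteq> 0" and gen: "\<And>x. x \<noteq> 0 \<Longrightarrow> \<exists>i. x = g ^ i"
    using ex_primitive_element by blast
  define N where "N = (LEAST n. 0 < n \<and> g ^ n = 1)"
  \<comment> \<open>That the inverse of \<open>g\<close> is a power of \<open>g\<close> shows that
    some positive power is 1, so the \<open>LEAST\<close> defining the order \<open>N\<close>
    exists.\<close>
  obtain i where "inverse g = g ^ i"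
    using gen[of "inverse g"] g by auto
  then have "g ^ Suc i = 1"
    using g by (metis power_Suc right_inverse)
  then have N: "0 < N \<and> g ^ N = 1"
    unfolding N_def by (rule LeastI[of "\<lambda>n. 0 < n \<and> g ^ n = 1" "Suc i", OF conjI, rotated]) simp
  define \<zeta> where "\<zeta> = cis (2 * pi / N)"
  have "\<zeta> \<noteq> 0"
    by (simp add: \<zeta>_def)
  have pow_\<zeta>: "\<zeta> ^ n = cis (2 * pi * real n / real N)" for n
    by (simp add: \<zeta>_def DeMoivre mult_ac)
  have \<zeta>N: "\<zeta> ^ N = 1"
    using N by (simp add: pow_\<zeta>)
  have order_g: "g ^ n = 1 \<longleftrightarrow> N dvd n" for n
  proof -
    have "g ^ n = g ^ (n mod N)"
      using N by (intro power_mod_exponent) simp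
    moreover have "g ^ (n mod N) \<noteq> 1" if "n mod N \<noteq> 0"
      using not_less_Least[of "n mod N" "\<lambda>n. 0 < n \<and> g ^ n = 1"] that N
      by (auto simp flip: N_def)
    ultimately show ?thesis
      by (auto simp: dvd_eq_mod_eq_0)
  qed
  have order_\<zeta>: "\<zeta> ^ n = 1 \<longleftrightarrow> N dvd n" for n
  proof -
    have red: "\<zeta> ^ n = \<zeta> ^ (n mod N)"
      using \<zeta>N by (rule power_mod_exponent)
    have "inj_on (\<lambda>k. \<zeta> ^ k) {..<N}"
      using bij_betw_roots_unity[of N] N by (simp add: bij_betw_def pow_\<zeta>)
    then have "\<zeta> ^ (n mod N) = \<zeta> ^ 0 \<longleftrightarrow> n mod N = 0"
      using N by (intro inj_on_eq_iff) auto
    then show ?thesis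
      using red by (simp add: dvd_eq_mod_eq_0)
  qed
  \<comment> \<open>Both \<open>g\<close> and \<zeta> have order \<open>N\<close>. Left to right,
    this makes the value of \<chi> independent of the exponent picked by \<open>SOME\<close>; right
    to left, it makes \<chi> injective on nonzero elements.\<close>
  have same: "g ^ i = g ^ j \<longleftrightarrow> \<zeta> ^ i = \<zeta> ^ j" for i j
  proof -
    have le: "g ^ i = g ^ j \<longleftrightarrow> \<zeta> ^ i = \<zeta> ^ j" if "i \<le> j" for i j
      using that g \<open>\<zeta> \<noteq> 0\<close> by (simp add: power_eq_power_iff_diff order_g order_\<zeta>)
    show ?thesis
      using le[of i j] le[of j i] by (cases "i \<le> j") auto
  qed
  define \<chi> where "\<chi> x = (if x = 0 then 0 else \<zeta> ^ (SOME i. x = g ^ i))" for x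
  have \<chi>: "\<chi> (g ^ i) = \<zeta> ^ i" for i
  proof -
    have "g ^ i = g ^ (SOME j. g ^ i = g ^ j)"
      by (rule someI[of _ i]) simp
    then show ?thesis
      using g by (simp add: \<chi>_def same)
  qed
  have "mult_char \<chi>"
    unfolding mult_char_def
  proof (intro conjI allI impI)
    fix x y :: 'a
    assume "x \<noteq> 0" "y \<noteq> 0"
    then obtain i j where "x = g ^ i" "y = g ^ j"
      using gen by meson
    then show "\<chi> (x * y) = \<chi> x * \<chi> y"
      by (simp add: \<chi> flip: power_add)
  qed (simp_all add: \<chi>_def \<zeta>_def)
  moreover have "x = 1" if "\<chi> x = 1" for x
  proof -
    have "x \<noteq> 0"
      using that by (auto simp: \<chi>_def)
    then obtain i where "x = g ^ i"
      using gen by blast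
    then show "x = 1"
      using that same[of i 0] by (simp add: \<chi>)
  qed
  ultimately show ?thesis
    by blast
qed

text \<open>The squares are closed under products and quotients; the remaining case, that a product
  of two nonsquares is a square, comes from the parity of exponents of a generator.\<close>

lemma mult_char_quad_char: "mult_char (quad_char :: 'a::{field,finite} \<Rightarrow> complex)"
proof -
  obtain g :: 'a where g: "g \<noteq> 0" and gen: "\<And>x. x \<noteq> 0 \<Longrightarrow> \<exists>i. x = g ^ i"
    using ex_primitive_element by blast
  let ?sq = "\<lambda>x::'a. \<exists>z. x = z\<^sup>2"
  have "?sq (x * y) \<longleftrightarrow> (?sq x \<longleftrightarrow> ?sq y)" if x: "x \<noteq> 0" and y: "y \<noteq> 0" for x y
  proof -
    have cancel: "?sq v" if u: "?sq u" and uv: "?sq (u * v)" and "u \<noteq> 0" for u v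
    proof -
      obtain s t where "u = s\<^sup>2" "u * v = t\<^sup>2"
        using u uv by blast
      then have "v = (t / s)\<^sup>2"
        using \<open>u \<noteq> 0\<close> by (simp add: power_divide field_simps)
      then show ?thesis ..
    qed
    have "?sq (x * y)" if "\<not> ?sq x" "\<not> ?sq y"
    proof -
      obtain i j where ij: "x = g ^ i" "y = g ^ j"
        using gen x y by meson
      \<comment> \<open>Even powers of \<open>g\<close> are squares, so both exponents are odd and
        their sum is even.\<close>
      have "odd k" if "\<not> ?sq (g ^ k)" for k
        using that by (metis evenE mult.commute power_mult)
      with that ij have "even (i + j)"
        by simp
      then show ?thesis
        unfolding ij by (metis evenE mult.commute power_add power_mult)
    qed
    moreover have "?sq (x * y)" if "?sq x" "?sq y"
      using that by (metis power_mult_distrib)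
    ultimately show ?thesis
      using cancel[of x y] cancel[of y x] x y by (auto simp: mult.commute)
  qed
  then show ?thesis
    unfolding mult_char_def quad_char_def by auto
qed

lemma quad_char_square: "quad_char x * quad_char x = triv_char x"
  by (simp add: quad_char_def triv_char_def)

section \<open>Orthogonality\<close>

lemma sum_triv_char:
  "(\<Sum>x\<in>UNIV. triv_char (x::'a::{field,finite})) = of_nat CARD('a) - 1"
proof -
  have "(\<Sum>x\<in>UNIV. triv_char (x::'a)) = (\<Sum>x\<in>UNIV. 1 - (if x = (0::'a) then 1 else 0))"
    by (intro sum.cong) (auto simp: triv_char_def)
  then show ?thesis
    by (simp add: sum_subtractf)
qed

text \<open>If \<chi> is nontrivial, pick \<open>a\<close> with \<chi>(a) different from 0 and 1.
  Substituting \<open>a * x\<close> for \<open>x\<close> multiplies the sum by \<chi>(a), so it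
  vanishes.\<close>

lemma sum_mult_char:
  fixes \<chi> :: "'a::{field,finite} \<Rightarrow> complex"
  assumes "mult_char \<chi>"
  shows "(\<Sum>x\<in>UNIV. \<chi> x) = (if \<chi> = triv_char then of_nat CARD('a) - 1 else 0)"
proof (cases "\<chi> = triv_char")
  case False
  then obtain a where "\<chi> a \<noteq> triv_char a"
    by blast
  then have a: "a \<noteq> 0" "\<chi> a \<noteq> 1"
    using mult_char_0[OF assms] by (auto simp: triv_char_def split: if_splits)
  have "(\<Sum>x\<in>UNIV. \<chi> x) = (\<Sum>x\<in>UNIV. \<chi> (a * x))"
    by (rule sum.reindex_bij_witness[of _ "\<lambda>x. a * x" "\<lambda>x. x / a"]) (use a in auto)
  also have "\<dots> = \<chi> a * (\<Sum>x\<in>UNIV. \<chi> x)"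
    by (simp add: mult_char_mult[OF assms] sum_distrib_left)
  finally show ?thesis
    using a False by simp
qed (simp add: sum_triv_char)

text \<open>These identities make multiplication by a fixed character a permutation of the
  characters, which justifies reindexing sums over them.\<close>

lemma char_mult_char_inv_cancel:
  assumes "mult_char A" "mult_char B"
  shows "char_mult A (char_mult (char_inv A) B) = B"
    and "char_mult (char_inv A) (char_mult A B) = B"
proof -
  have "A x * (inverse (A x) * B x) = B x" for x
    using assms by (cases "x = 0") (simp_all add: mult_char_0 mult_char_eq_0_iff)
  then show "char_mult A (char_mult (char_inv A) B) = B"
    and "char_mult (char_inv A) (char_mult A B) = B"
    by (simp_all add: char_mult_def char_inv_def fun_eq_iff mult.left_commute)
qed

text \<open>Dual to the previous orthogonality: for \<open>x\<close> other than 1, multiplying all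
  characters by the faithful \<eta> scales the sum by \<eta>(x), which is not 1.\<close>

lemma sum_over_mult_chars:
  fixes x :: "'a::{field,finite}"
  shows "(\<Sum>\<chi> | mult_char \<chi>. \<chi> x) = (if x = 1 then of_nat CARD('a) - 1 else 0)"
proof -
  obtain \<eta> :: "'a \<Rightarrow> complex" where \<eta>: "mult_char \<eta>" "\<And>x. \<eta> x = 1 \<Longrightarrow> x = 1"
    using ex_faithful_char by blast
  have zero: "(\<Sum>\<chi> | mult_char \<chi>. \<chi> x) = 0" if "x \<noteq> 1" for x :: 'a
  proof -
    have "(\<Sum>\<chi> | mult_char \<chi>. \<chi> x) = (\<Sum>\<chi> | mult_char \<chi>. char_mult \<eta> \<chi> x)"
      by (rule sum.reindex_bij_witness[of _ "char_mult \<eta>" "char_mult (char_inv \<eta>)"])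
        (simp_all add: \<eta> mult_char_char_mult mult_char_char_inv char_mult_char_inv_cancel)
    also have "\<dots> = \<eta> x * (\<Sum>\<chi> | mult_char \<chi>. \<chi> x)"
      by (simp add: char_mult_def sum_distrib_left)
    finally show ?thesis
      using that \<eta> by auto
  qed
  \<comment> \<open>The number of characters is obtained by counting the total sum over \<open>\<chi>\<close> and \<open>x\<close> in two ways.\<close>
  have "(\<Sum>\<chi> | mult_char \<chi>. \<chi> (1::'a)) =
      (\<Sum>x\<in>UNIV. if x = (1::'a) then \<Sum>\<chi> | mult_char \<chi>. \<chi> x else 0)"
    by simp
  also have "\<dots> = (\<Sum>x\<in>UNIV. \<Sum>\<chi> | mult_char \<chi>. \<chi> (x::'a))"
    by (intro sum.cong) (simp_all add: zero)
  also have "\<dots> = (\<Sum>\<chi> | mult_char \<chi>. \<Sum>x\<in>UNIV. \<chi> (x::'a))"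
    by (rule sum.swap)
  also have "\<dots> = (\<Sum>\<chi> | mult_char \<chi>.
      if \<chi> = (triv_char :: 'a \<Rightarrow> complex) then of_nat CARD('a) - 1 else 0)"
    by (intro sum.cong) (simp_all add: sum_mult_char)
  also have "\<dots> = of_nat CARD('a) - 1"
    by (simp add: sum.delta finite_mult_chars mult_char_triv_char)
  finally show ?thesis
    using zero by auto
qed

section \<open>The binomials and the hypergeometric functions\<close>

definition quad_binom :: "('a::{field,finite} \<Rightarrow> complex) \<Rightarrow> complex" where
  "quad_binom \<chi> = char_binom (char_mult quad_char \<chi>) \<chi>"

lemma jacobi_sum_commute: "jacobi_sum A B = jacobi_sum B A"
  unfolding jacobi_sum_def
  by (rule sum.reindex_bij_witness[of _ "\<lambda>x. 1 - x" "\<lambda>x. 1 - x"]) (simp_all add: mult.commute)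

lemma quad_binom_reflect:
  fixes \<chi> :: "'a::{field,finite} \<Rightarrow> complex"
  assumes \<chi>: "mult_char \<chi>"
  shows "quad_binom (char_mult quad_char (char_inv \<chi>)) = quad_char (- 1 :: 'a) * quad_binom \<chi>"
proof -
  have inv: "char_mult quad_char (char_mult quad_char (char_inv \<chi>)) = char_inv \<chi>"
    using \<chi> by (auto simp: fun_eq_iff char_mult_def char_inv_def quad_char_square triv_char_def
        mult_char_0 simp flip: mult.assoc)
  have "char_inv (char_mult quad_char (char_inv \<chi>)) = char_mult quad_char \<chi>"
    by (auto simp: fun_eq_iff char_mult_def char_inv_def quad_char_def)
  then have "quad_binom (char_mult quad_char (char_inv \<chi>)) =
      quad_char (- 1 :: 'a) * inverse (\<chi> (- 1)) / of_nat CARD('a) *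
        jacobi_sum (char_inv \<chi>) (char_mult quad_char \<chi>)"
    by (simp add: quad_binom_def char_binom_def inv) (simp add: char_mult_def char_inv_def)
  also have "\<dots> = quad_char (- 1 :: 'a) * quad_binom \<chi>"
    by (simp add: quad_binom_def char_binom_def mult_char_inverse_minus_1[OF \<chi>]
        jacobi_sum_commute[of "char_inv \<chi>"])
  finally show ?thesis .
qed

lemma card_field_minus_1_neq_0: "of_nat CARD('a::{field,finite}) - 1 \<noteq> (0::complex)"
proof -
  have "card {0, 1 :: 'a} \<le> CARD('a)"
    by (rule card_mono) simp_all
  then show ?thesis
    by auto
qed

text \<open>All values of \<chi> are collected into one, so that summing over \<chi> becomes an
  instance of orthogonality. At \<open>y = 1\<close> both sides contribute 0, as
  \<open>inverse 0 = 0\<close> and \<chi>(0) = 0.\<close>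

lemma quad_binom_times_char:
  fixes \<chi> :: "'a::{field,finite} \<Rightarrow> complex"
  assumes \<chi>: "mult_char \<chi>"
  shows "of_nat CARD('a) * (quad_binom \<chi> * \<chi> x) =
    (\<Sum>y\<in>UNIV. quad_char y * \<chi> (- 1 * y * x * inverse (1 - y)))"
  by (simp add: quad_binom_def char_binom_def jacobi_sum_def char_mult_def char_inv_def
      mult_char_mult[OF \<chi>] mult_char_inverse[OF \<chi>] sum_distrib_left sum_distrib_right mult_ac
      del: mult_minus_left mult_minus_right mult_minus1 mult_minus1_right)

lemma hypF_0_eq_char_sum:
  fixes x :: "'a::{field,finite}"
  shows "triv_char x * quad_char (1 - x) =
    of_nat CARD('a) / (of_nat CARD('a) - 1) * (\<Sum>\<chi> | mult_char \<chi>. quad_binom \<chi> * \<chi> x)"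
proof -
  let ?q = "of_nat CARD('a) :: complex"
  \<comment> \<open>Orthogonality keeps only the \<open>y\<close> that make this argument 1. The
    equation reads \<open>y * (1 - x) = 1\<close>; \<open>x = 1\<close> has no solution, and
    \<open>x = 0\<close> would give the excluded \<open>y = 1\<close>.\<close>
  have solve: "- 1 * y * x * inverse (1 - y) = 1 \<longleftrightarrow> y = inverse (1 - x) \<and> x \<noteq> 0 \<and> x \<noteq> 1" for y
    by (cases "y = 1"; cases "x = 1") (auto simp: field_simps)
  have "?q * (\<Sum>\<chi> | mult_char \<chi>. quad_binom \<chi> * \<chi> x) =
      (\<Sum>\<chi> | mult_char \<chi>. \<Sum>y\<in>UNIV. quad_char y * \<chi> (- 1 * y * x * inverse (1 - y)))"
    unfolding sum_distrib_left by (intro sum.cong refl quad_binom_times_char) simp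
  also have "\<dots> = (\<Sum>y\<in>UNIV. quad_char y * (\<Sum>\<chi> | mult_char \<chi>. \<chi> (- 1 * y * x * inverse (1 - y))))"
    unfolding sum_distrib_left by (rule sum.swap)
  also have "\<dots> = (\<Sum>y\<in>UNIV. if y = inverse (1 - x)
      then if x \<noteq> 0 \<and> x \<noteq> 1 then quad_char y * (?q - 1) else 0 else 0)"
    unfolding sum_over_mult_chars solve by (intro sum.cong) auto
  also have "\<dots> = (?q - 1) * (triv_char x * quad_char (inverse (1 - x)))"
    by (simp add: triv_char_def quad_char_def)
  \<comment> \<open>The values of \<phi> are 0, 1 and -1, each its own inverse in the complex
    numbers.\<close>
  also have "quad_char (inverse (1 - x)) = quad_char (1 - x)"
    unfolding mult_char_inverse[OF mult_char_quad_char] by (simp add: quad_char_def)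
  finally show ?thesis
    using card_field_minus_1_neq_0[where 'a = 'a] by (simp add: field_simps)
qed

text \<open>One formula for all indices, including 0, lets the convolution below cover the factor
  \<open>hypF 0\<close> that arises for \<open>k = 1\<close>.\<close>

lemma hypF_eq_char_sum:
  fixes x :: "'a::{field,finite}"
  shows "hypF n x = of_nat CARD('a) / (of_nat CARD('a) - 1) *
    (\<Sum>\<chi> | mult_char \<chi>. quad_binom \<chi> ^ (n + 1) * \<chi> x)"
  by (cases "n = 0") (simp_all add: hypF_def hypF_0_eq_char_sum flip: quad_binom_def)

text \<open>The summand is the character \<phi>\<chi>\<psi>, which is trivial exactly when \<psi> is
  the inverse of \<phi>\<chi>; as \<phi> is its own inverse, this is \<phi>\<chi>\<inverse>.\<close>

lemma sum_quad_char_times_chars: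
  fixes \<chi> \<psi> :: "'a::{field,finite} \<Rightarrow> complex"
  assumes \<chi>: "mult_char \<chi>" and \<psi>: "mult_char \<psi>"
  shows "(\<Sum>l\<in>UNIV. quad_char l * \<chi> l * \<psi> l) =
    (if \<psi> = char_mult quad_char (char_inv \<chi>) then of_nat CARD('a) - 1 else 0)"
proof -
  let ?A = "char_mult quad_char \<chi>"
  have A: "mult_char ?A"
    by (simp add: mult_char_char_mult mult_char_quad_char \<chi>)
  have inv: "char_inv ?A = char_mult quad_char (char_inv \<chi>)"
    by (auto simp: fun_eq_iff char_mult_def char_inv_def quad_char_def)
  have "char_mult ?A \<psi> = triv_char \<longleftrightarrow> \<psi> = char_inv ?A"
  proof
    assume "char_mult ?A \<psi> = triv_char"
    then have "\<psi> = char_mult (char_inv ?A) triv_char"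
      using char_mult_char_inv_cancel(2)[OF A \<psi>] by simp
    also have "\<dots> = char_inv ?A"
      using A by (auto simp: fun_eq_iff char_mult_def char_inv_def triv_char_def quad_char_def)
    finally show "\<psi> = char_inv ?A" .
  next
    assume "\<psi> = char_inv ?A"
    then show "char_mult ?A \<psi> = triv_char"
      using mult_char_eq_0_iff[OF A] by (simp add: fun_eq_iff char_mult_def[of ?A] char_inv_def triv_char_def)
  qed
  then show ?thesis
    using sum_mult_char[OF mult_char_char_mult[OF A \<psi>]] by (simp add: char_mult_def inv)
qed

text \<open>Index \<open>j\<close> belongs to the binomial power \<open>j + 1\<close>, so the powers
  \<open>m + 1\<close> and \<open>k + 1\<close> combine to \<open>m + k + 2\<close>, that is, index
  \<open>m + k + 1\<close>. Reflection contributes the \<open>k + 1\<close> signs.\<close>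

lemma hypF_convolution:
  fixes x :: "'a::{field,finite}"
  shows "(\<Sum>l\<in>UNIV. quad_char l * hypF m (l * x) * hypF k l) =
    of_nat CARD('a) * quad_char (- 1 :: 'a) ^ (k + 1) * hypF (m + k + 1) x"
proof -
  let ?q = "of_nat CARD('a) :: complex" and ?C = "{\<chi> :: 'a \<Rightarrow> complex. mult_char \<chi>}"
  let ?b = "quad_binom :: ('a \<Rightarrow> complex) \<Rightarrow> complex"
  define c where "c = ?q / (?q - 1)"
  have hypF: "hypF j y = c * (\<Sum>\<chi>\<in>?C. ?b \<chi> ^ (j + 1) * \<chi> y)" for j y
    by (simp add: hypF_eq_char_sum c_def)
  have "(\<Sum>l\<in>UNIV. quad_char l * hypF m (l * x) * hypF k l) =
      (\<Sum>l\<in>UNIV. \<Sum>\<chi>\<in>?C. \<Sum>\<psi>\<in>?C.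
        c * c * (?b \<chi> ^ (m + 1) * ?b \<psi> ^ (k + 1) * \<chi> x) * (quad_char l * \<chi> l * \<psi> l))"
    by (intro sum.cong refl)
      (simp add: hypF sum_distrib_left sum_distrib_right sum_product mult_char_mult mult_ac
        cong: sum.cong_simp)
  also have "\<dots> = (\<Sum>\<chi>\<in>?C. \<Sum>\<psi>\<in>?C. \<Sum>l\<in>UNIV.
        c * c * (?b \<chi> ^ (m + 1) * ?b \<psi> ^ (k + 1) * \<chi> x) * (quad_char l * \<chi> l * \<psi> l))"
    by (subst sum.swap, intro sum.cong refl sum.swap)
  also have "\<dots> = (\<Sum>\<chi>\<in>?C. \<Sum>\<psi>\<in>?C. if \<psi> = char_mult quad_char (char_inv \<chi>)
      then c * c * (?b \<chi> ^ (m + 1) * ?b \<psi> ^ (k + 1) * \<chi> x) * (?q - 1) else 0)"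
    unfolding sum_distrib_left[symmetric]
    by (intro sum.cong refl) (simp add: sum_quad_char_times_chars)
  also have "\<dots> = (\<Sum>\<chi>\<in>?C. c * c * (?b \<chi> ^ (m + 1) *
      ?b (char_mult quad_char (char_inv \<chi>)) ^ (k + 1) * \<chi> x) * (?q - 1))"
    by (intro sum.cong refl)
      (simp add: finite_mult_chars mult_char_char_mult mult_char_char_inv mult_char_quad_char)
  also have "\<dots> = (\<Sum>\<chi>\<in>?C. ?q * quad_char (- 1 :: 'a) ^ (k + 1) *
      (c * (?b \<chi> ^ (m + k + 1 + 1) * \<chi> x)))"
  proof (intro sum.cong refl)
    fix \<chi> :: "'a \<Rightarrow> complex"
    assume "\<chi> \<in> ?C"
    then have *: "?b (char_mult quad_char (char_inv \<chi>)) = quad_char (- 1 :: 'a) * ?b \<chi>"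
      by (simp add: quad_binom_reflect)
    \<comment> \<open>The factor \<open>?q - 1\<close> from orthogonality cancels one of the two
      normalizations \<open>c\<close> down to \<open>?q\<close>; the other remains for the resulting
      function.\<close>
    have "c * (?q - 1) = ?q"
      using card_field_minus_1_neq_0[where 'a = 'a] by (simp add: c_def)
    then have c: "c * c * t * (?q - 1) = ?q * (c * t)" for t
      by (metis mult.assoc mult.commute)
    show "c * c * (?b \<chi> ^ (m + 1) * ?b (char_mult quad_char (char_inv \<chi>)) ^ (k + 1) * \<chi> x) *
        (?q - 1) = ?q * quad_char (- 1 :: 'a) ^ (k + 1) * (c * (?b \<chi> ^ (m + k + 1 + 1) * \<chi> x))"
      unfolding * c by (simp add: power_mult_distrib power_add mult_ac)
  qed
  also have "\<dots> = ?q * quad_char (- 1 :: 'a) ^ (k + 1) * hypF (m + k + 1) x"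
    by (simp add: hypF sum_distrib_left)
  finally show ?thesis .
qed

theorem theorem4p5:
  fixes q :: nat
  assumes "prime q" and "odd q"
    and "CARD('a::{field,finite}) = q"
  shows "(\<forall>(n::nat) (k::nat) (x::'a). 1 \<le> k \<and> k < n \<longrightarrow>
           hypF n x = quad_char (- 1 :: 'a) ^ k / of_nat q *
             (\<Sum>l\<in>UNIV. quad_char l * hypF (n - k) (l * x) * hypF (k - 1) l))
       \<and> (\<forall>k::nat. 2 \<le> k \<longrightarrow>
           of_nat q * quad_char (- 1 :: 'a) ^ k * hypF (2 * k - 1) (1 :: 'a) =
             (\<Sum>l\<in>(UNIV :: 'a set). quad_char l * (hypF (k - 1) l)\<^sup>2))"
proof (intro conjI allI impI)
  fix n k :: nat and x :: 'a
  assume nk: "1 \<le> k \<and> k < n"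
  \<comment> \<open>The sign squares to 1, so it can be moved across the convolution
    identity.\<close>
  have "quad_char (- 1 :: 'a) ^ k * quad_char (- 1 :: 'a) ^ k = 1"
    by (simp add: mult_char_minus_1_square[OF mult_char_quad_char] flip: power_mult_distrib)
  moreover have "(of_nat q :: complex) \<noteq> 0"
    using assms(3) by auto
  moreover have "(\<Sum>l\<in>UNIV. quad_char l * hypF (n - k) (l * x) * hypF (k - 1) l) =
      of_nat q * quad_char (- 1 :: 'a) ^ k * hypF n x"
    using hypF_convolution[of "n - k" x "k - 1"] nk assms(3) by simp
  ultimately show "hypF n x = quad_char (- 1 :: 'a) ^ k / of_nat q *
      (\<Sum>l\<in>UNIV. quad_char l * hypF (n - k) (l * x) * hypF (k - 1) l)"
    by (simp flip: mult.assoc)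
next
  fix k :: nat
  assume k: "2 \<le> k"
  \<comment> \<open>The second claim is the convolution at \<open>x = 1\<close> with both indices
    \<open>k - 1\<close>.\<close>
  then have "k - 1 + (k - 1) + 1 = 2 * k - 1"
    by simp
  then show "of_nat q * quad_char (- 1 :: 'a) ^ k * hypF (2 * k - 1) (1 :: 'a) =
      (\<Sum>l\<in>(UNIV :: 'a set). quad_char l * (hypF (k - 1) l)\<^sup>2)"
    using hypF_convolution[of "k - 1" "1 :: 'a" "k - 1"] k assms(3)
    by (simp add: power2_eq_square mult.assoc)
qed

end
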